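(* Let $K$ be a martingale kernel on $(0,\infty)$ and, for $x>0$, let $S=(S_k)_{k\in\mathbb{N}_0}$ be under $\mathbb{P}_x$ the positive Markov martingale with transition kernel $K$ started from $S_0=x$. For $x>0$ let $$a(x):=\mathbb{P}_x[S_1<x]=K(x,(0,x)),\qquad b(x):=\mathbb{E}_x\Big[\frac{S_1}{x}\mathbf{1}_{\{S_1<x\}}\Big]=\int_{(0,x)}\frac{y}{x}\,K(x,\mathrm{d}y).$$ Suppose that $\inf_{x>0}a(x)>0$ and $\sup_{x>0}x\,b(x)<\infty$. Then $S$ is a bubble under $\mathbb{P}_x$ for all $x>0$ for which $S$ is not $\mathbb{P}_x$-a.s. bounded.
   Context: Martingale kernel: $K:(0,\infty)\times\mathcal{B}_{(0,\infty)}\to[0,\infty)$ is a Markov (probability) kernel on $(0,\infty)$ with $\int_{(0,\infty)}y\,K(x,\mathrm{d}y)=x$ for all $x>0$. For $x>0$, under $\mathbb{P}_x$ (with expectation $\mathbb{E}_x$) the process $S=(S_k)_{k\in\mathbb{N}_0}$ is the time-homogeneous Markov chain with $S_0=x$ and transition kernel $K$; it is a positive martingale, with $\mathbb{P}_x$-a.s. limit $S_\infty$. "$S$ is $\mathbb{P}_x$-a.s. bounded" means that there is a deterministic constant $C<\infty$ with $\mathbb{P}_x[S_k\le C \text{ for all } k\in\mathbb{N}_0]=1$. Definition (bubble): put $\tau_0:=0$ and $\tau_k:=\inf\{j>\tau_{k-1}: S_j<S_{j-1}\}$ for $k\in\mathbb{N}$ ($\inf\emptyset=\infty$), and $S_{\tau_k}:=S_\infty$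 on $\{\tau_k=\infty\}$. $S$ is a bubble under $\mathbb{P}_x$ (equivalently $\mathbb{P}_x$ is a bubble measure for $S$) if $\mathbb{E}_x[S_{\tau_k}]<\mathbb{E}_x[S_0]=x$ for some $k\in\mathbb{N}$. *)

theory Defs
  imports "HOL-Probability.Probability"
begin

abbreviation pos_borel :: "real measure" where
  "pos_borel \<equiv> restrict_space borel {0<..}"

text \<open>
  Membership in the measurable space of probability measures on \<open>(0,\<infinity>)\<close> says that \<open>K\<close> is a
  Markov kernel; nothing is required of \<open>K x\<close> for \<open>x \<le> 0\<close>.
\<close>
definition martingale_kernel :: "(real \<Rightarrow> real measure) \<Rightarrow> bool" where
  "martingale_kernel K \<longleftrightarrow>
     K \<in> pos_borel \<rightarrow>\<^sub>M prob_algebra pos_borel \<and>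
     (\<forall>x>0. has_bochner_integral (K x) (\<lambda>y. y) x)"

definition natural_filtration :: "'a measure \<Rightarrow> (nat \<Rightarrow> 'a \<Rightarrow> real) \<Rightarrow> nat \<Rightarrow> 'a measure" where
  "natural_filtration M S n =
     sigma (space M) {S i -` A \<inter> space M | i A. i \<le> n \<and> A \<in> sets pos_borel}"

definition markov_chain_from ::
    "(real \<Rightarrow> real measure) \<Rightarrow> real \<Rightarrow> 'a measure \<Rightarrow> (nat \<Rightarrow> 'a \<Rightarrow> real) \<Rightarrow> bool" where
  "markov_chain_from K x M S \<longleftrightarrow>
     prob_space M \<and>
     (\<forall>n. S n \<in> M \<rightarrow>\<^sub>M pos_borel) \<and>
     (AE \<omega> in M. S 0 \<omega> = x) \<and>
     (\<forall>n. \<forall>B\<in>sets pos_borel. AE \<omega> in M.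
        real_cond_exp M (natural_filtration M S n)
          (indicator (S (Suc n) -` B \<inter> space M)) \<omega> = measure (K (S n \<omega>)) B)"

definition as_bounded :: "'a measure \<Rightarrow> (nat \<Rightarrow> 'a \<Rightarrow> real) \<Rightarrow> bool" where
  "as_bounded M S \<longleftrightarrow> (\<exists>C. AE \<omega> in M. \<forall>k. S k \<omega> \<le> C)"

text \<open>In \<open>enat\<close> the infimum of the empty set is \<open>\<infinity>\<close>, and \<open>j > \<tau>\<close> forces \<open>j \<ge> 1\<close>.\<close>
primrec drop_time :: "(nat \<Rightarrow> 'a \<Rightarrow> real) \<Rightarrow> nat \<Rightarrow> 'a \<Rightarrow> enat" where
  "drop_time S 0 = (\<lambda>\<omega>. 0)"
| "drop_time S (Suc k) =
     (\<lambda>\<omega>. Inf {enat j | j. drop_time S k \<omega> < enat j \<and> S j \<omega> < S (j - 1) \<omega>})"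

text \<open>
  The value at \<open>\<infinity>\<close> is the pathwise limit, which exists almost surely for a positive martingale;
  \<open>lim\<close> is unspecified only on the null set where the path diverges.
\<close>
definition value_at :: "(nat \<Rightarrow> 'a \<Rightarrow> real) \<Rightarrow> ('a \<Rightarrow> enat) \<Rightarrow> 'a \<Rightarrow> real" where
  "value_at S T \<omega> = (case T \<omega> of enat j \<Rightarrow> S j \<omega> | \<infinity> \<Rightarrow> lim (\<lambda>n. S n \<omega>))"

text \<open>
  All values are almost surely nonnegative, so the expectations are taken as nonnegative
  integrals, which do not presuppose integrability.
\<close>
definition bubble :: "'a measure \<Rightarrow> (nat \<Rightarrow> 'a \<Rightarrow> real) \<Rightarrow> bool" where
  "bubble M S \<longleftrightarrow>
     (\<exists>k\<ge>1. (\<integral>\<^sup>+\<omega>. ennreal (value_at S (drop_time S k) \<omega>) \<partial>M) < (\<integral>\<^sup>+\<omega>. ennreal (S 0 \<omega>) \<partial>M))"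

definition drop_prob :: "(real \<Rightarrow> real measure) \<Rightarrow> real \<Rightarrow> real" where
  "drop_prob K x = measure (K x) {0<..<x}"

definition drop_mean :: "(real \<Rightarrow> real measure) \<Rightarrow> real \<Rightarrow> real" where
  "drop_mean K x = (LINT y:{0<..<x}|K x. y / x)"

end

theory Submission
  imports Defs
begin

text \<open>
  Write \<open>c\<close> for the infimum of \<open>a\<close> and \<open>C\<close> for a bound of \<open>y b(y)\<close>. Since every step drops with
  probability at least \<open>c\<close>, all \<open>\<tau>\<^sub>k\<close> are almost surely finite, and
  \<open>E[S at \<tau>\<^sub>k; \<tau>\<^sub>k \<le> n] = x - E[S\<^sub>n; \<tau>\<^sub>k > n]\<close>. So it suffices that the last expectation stays away
  from \<open>0\<close> for some \<open>k\<close>. If \<open>S\<close> is not bounded, some \<open>S\<^sub>j\<close> exceeds \<open>C / c\<close> on an event \<open>A\<close> of positive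
  probability. With \<open>U\<^sub>n\<close> the part of \<open>A\<close> on which no drop occurs in \<open>(j, n]\<close>, a drop removes
  at most \<open>C P(U\<^sub>n)\<close> from the mean and at least \<open>c P(U\<^sub>n)\<close> from the probability, hence
  \<open>E[S\<^sub>n - C / c; U\<^sub>n]\<close> is nondecreasing in \<open>n\<close> and bounds \<open>E[S\<^sub>n; \<tau>\<^sub>k > n]\<close> from below for \<open>k = j + 1\<close>.
\<close>

section \<open>Filtration and measurability of the chain\<close>

locale martingale_chain = prob_space M for M :: "'a measure" +
  fixes K :: "real \<Rightarrow> real measure" and x :: real and S :: "nat \<Rightarrow> 'a \<Rightarrow> real"
  assumes kernel: "martingale_kernel K"
    and chain: "markov_chain_from K x M S"
begin

abbreviation F :: "nat \<Rightarrow> 'a measure" where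
  "F \<equiv> natural_filtration M S"

lemma S_measurable [measurable]: "S n \<in> M \<rightarrow>\<^sub>M pos_borel"
  using chain by (simp add: markov_chain_from_def)

lemma S_borel_measurable [measurable]: "S n \<in> borel_measurable M"
  using S_measurable[of n] by (rule measurable_restrict_space2_iff[THEN iffD1, THEN conjunct1])

lemma S_pos: "\<omega> \<in> space M \<Longrightarrow> 0 < S n \<omega>"
  using measurable_space[OF S_measurable, of \<omega> n] by (simp add: space_restrict_space)

lemma space_F [simp]: "space (F n) = space M"
  unfolding natural_filtration_def by (rule space_measure_of) auto

lemma S_measurable_F: "i \<le> n \<Longrightarrow> S i \<in> F n \<rightarrow>\<^sub>M pos_borel"
proof (rule measurableI)
  fix A :: "real set" assume "i \<le> n" "A \<in> sets pos_borel"
  then have "S i -` A \<inter> space M \<in> sets (F n)"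
    unfolding natural_filtration_def by (intro in_measure_of) blast+
  then show "S i -` A \<inter> space (F n) \<in> sets (F n)" by simp
qed (simp add: S_pos space_restrict_space)

lemma S_borel_measurable_F: "i \<le> n \<Longrightarrow> S i \<in> borel_measurable (F n)"
  using S_measurable_F by (metis measurable_restrict_space2_iff)

lemma subalgebra_F: "subalgebra M (F n)"
proof -
  have "sets (F n) \<subseteq> sets M"
    unfolding natural_filtration_def
    by (rule sets_measure_of[THEN ord_eq_le_trans])
       (auto intro!: sets.sigma_sets_subset measurable_sets[OF S_measurable])
  then show ?thesis by (simp add: subalgebra_def)
qed

lemma sets_F_imp_sets_M: "A \<in> sets (F n) \<Longrightarrow> A \<in> sets M"
  using subalgebra_F by (auto simp: subalgebra_def)

lemma sets_F_mono:
  assumes "m \<le> n" and "A \<in> sets (F m)"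
  shows "A \<in> sets (F n)"
proof -
  have "sets (F m) \<subseteq> sets (F n)"
    unfolding natural_filtration_def using \<open>m \<le> n\<close>
    by (subst (1 2) sets_measure_of) (blast dest: le_trans intro!: sigma_sets_mono')+
  with assms show ?thesis by auto
qed

lemma drop_in_F: "{\<omega> \<in> space M. S (Suc i) \<omega> < S i \<omega>} \<in> sets (F (Suc i))"
proof -
  have [measurable]: "S i \<in> borel_measurable (F (Suc i))" "S (Suc i) \<in> borel_measurable (F (Suc i))"
    by (auto intro: S_borel_measurable_F)
  have "{\<omega> \<in> space (F (Suc i)). S (Suc i) \<omega> < S i \<omega>} \<in> sets (F (Suc i))"
    by measurable
  then show ?thesis by simp
qed

section \<open>The Markov property as an identity of integrals\<close>

lemma kernel_measurable [measurable]: "K \<in> pos_borel \<rightarrow>\<^sub>M subprob_algebra pos_borel"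
  using kernel by (auto simp: martingale_kernel_def intro: measurable_prob_algebraD)

lemma kernel_prob_space: "0 < y \<Longrightarrow> prob_space (K y)"
  and sets_K: "0 < y \<Longrightarrow> sets (K y) = sets pos_borel"
  using kernel measurable_space[of K pos_borel "prob_algebra pos_borel" y]
  by (auto simp: martingale_kernel_def space_prob_algebra space_restrict_space)

text \<open>Integrating the conditional probability over an event of the past removes the
  conditional expectation. The identity is the value on rectangles of the joint law treated in
  \<open>one_step\<close>.\<close>

lemma kernel_rectangle:
  assumes A: "A \<in> sets (F n)" and B: "B \<in> sets pos_borel"
  shows "emeasure M (A \<inter> S (Suc n) -` B) = (\<integral>\<^sup>+\<omega>\<in>A. emeasure (K (S n \<omega>)) B \<partial>M)"
proof -
  interpret sub: finite_measure_subalgebra M "F n"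
    by unfold_locales (rule subalgebra_F)
  have A_M [measurable]: "A \<in> sets M" using A by (rule sets_F_imp_sets_M)
  note B [measurable]
  have SB [measurable]: "S (Suc n) -` B \<inter> space M \<in> sets M" by measurable
  have K_prob: "\<omega> \<in> space M \<Longrightarrow> emeasure (K (S n \<omega>)) B = ennreal (measure (K (S n \<omega>)) B)" for \<omega>
    using kernel_prob_space[OF S_pos]
    by (simp add: finite_measure.emeasure_eq_measure prob_space.finite_measure)
  have [measurable]: "(\<lambda>\<omega>. measure (K (S n \<omega>)) B) \<in> borel_measurable M"
    by measurable
  have int: "integrable M (\<lambda>\<omega>. indicator A \<omega> * measure (K (S n \<omega>)) B)"
  proof (rule integrable_const_bound[where B = 1])
    show "AE \<omega> in M. norm (indicator A \<omega> * measure (K (S n \<omega>)) B) \<le> 1"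
      using kernel_prob_space[OF S_pos] by (auto simp: indicator_def prob_space.prob_le_1)
  qed measurable
  have "emeasure M (A \<inter> S (Suc n) -` B) = ennreal (measure M (A \<inter> (S (Suc n) -` B \<inter> space M)))"
    using sets.sets_into_space[OF A_M]
    by (auto simp: emeasure_eq_measure intro!: arg_cong[where f = "measure M"])
  also have "measure M (A \<inter> (S (Suc n) -` B \<inter> space M)) =
      (\<integral>\<omega>\<in>A. indicator (S (Suc n) -` B \<inter> space M) \<omega> \<partial>M)"
    using SB A_M by (simp add: set_lebesgue_integral_def flip: indicator_inter_arith)
  also have "\<dots> = (\<integral>\<omega>\<in>A. real_cond_exp M (F n) (indicator (S (Suc n) -` B \<inter> space M)) \<omega> \<partial>M)"
    by (rule sub.real_cond_exp_intA) (use A SB in \<open>auto simp: emeasure_eq_measure\<close>)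
  also have "\<dots> = (\<integral>\<omega>\<in>A. measure (K (S n \<omega>)) B \<partial>M)"
    unfolding set_lebesgue_integral_def
  proof (rule integral_cong_AE)
    have "AE \<omega> in M. real_cond_exp M (F n) (indicator (S (Suc n) -` B \<inter> space M)) \<omega> =
        measure (K (S n \<omega>)) B"
      using chain B by (simp add: markov_chain_from_def)
    then show "AE \<omega> in M. indicator A \<omega> *\<^sub>R
          real_cond_exp M (F n) (indicator (S (Suc n) -` B \<inter> space M)) \<omega> =
        indicator A \<omega> *\<^sub>R measure (K (S n \<omega>)) B"
      by eventually_elim simp
  qed measurable
  also have "ennreal \<dots> = (\<integral>\<^sup>+\<omega>. ennreal (indicator A \<omega> * measure (K (S n \<omega>)) B) \<partial>M)"
    unfolding set_lebesgue_integral_def real_scaleR_def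
    by (rule nn_integral_eq_integral[symmetric, OF int]) (auto simp: indicator_def)
  also have "\<dots> = (\<integral>\<^sup>+\<omega>\<in>A. emeasure (K (S n \<omega>)) B \<partial>M)"
    by (intro nn_integral_cong) (auto simp: K_prob indicator_def)
  finally show ?thesis .
qed

text \<open>A drop compares \<open>S (Suc n)\<close> with \<open>S n\<close>, so the Markov property
  is needed for functions of both, not only for a fixed target set. The joint law on
  \<open>A\<close> and the law built from the kernel agree on rectangles, which form an
  intersection-stable generator, and both are finite; hence they coincide.\<close>

lemma one_step:
  assumes A: "A \<in> sets (F n)" and f [measurable]: "f \<in> borel_measurable (pos_borel \<Otimes>\<^sub>M pos_borel)"
  shows "(\<integral>\<^sup>+\<omega>\<in>A. f (S n \<omega>, S (Suc n) \<omega>) \<partial>M) =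
    (\<integral>\<^sup>+\<omega>\<in>A. (\<integral>\<^sup>+y. f (S n \<omega>, y) \<partial>K (S n \<omega>)) \<partial>M)"
proof -
  let ?MA = "density M (indicator A)"
  let ?PP = "pos_borel \<Otimes>\<^sub>M pos_borel"
  \<comment> \<open>\<open>J\<close> is the law of two consecutive values on the event
    \<open>A\<close>; \<open>N \<omega>\<close> keeps the present value and draws the next one from
    the kernel. Restricting to \<open>A\<close> by a density leaves the space and the measurable
    sets of \<open>M\<close> unchanged.\<close>
  define J where "J = distr ?MA ?PP (\<lambda>\<omega>. (S n \<omega>, S (Suc n) \<omega>))"
  define N where "N = (\<lambda>\<omega>. distr (K (S n \<omega>)) ?PP (\<lambda>y. (S n \<omega>, y)))"
  have A_M [measurable]: "A \<in> sets M" using A by (rule sets_F_imp_sets_M)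
  have N_meas: "N \<in> ?MA \<rightarrow>\<^sub>M subprob_algebra ?PP"
    unfolding N_def by (rule measurable_distr2[where M = pos_borel]) measurable
  have N_meas' [measurable]: "N \<in> M \<rightarrow>\<^sub>M subprob_algebra ?PP"
    using N_meas by simp
  have nonempty: "space ?MA \<noteq> {}" using not_empty by simp
  have pair_meas: "(\<lambda>y. (S n \<omega>, y)) \<in> K (S n \<omega>) \<rightarrow>\<^sub>M ?PP" if "\<omega> \<in> space M" for \<omega>
    using S_pos[OF that, of n] by (subst measurable_cong_sets[OF sets_K refl])
      (auto intro!: measurable_Pair1' simp: space_restrict_space)
  have fin: "emeasure J (space ?PP) \<noteq> \<infinity>"
    unfolding J_def using emeasure_finite[of A] sets.sets_into_space[OF A_M]
    by (subst emeasure_distr)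
       (auto simp: emeasure_density nn_integral_indicator Int_absorb2
           measurable_sets measurable_Pair simp flip: indicator_inter_arith)
  have "J = ?MA \<bind> N"
  proof (rule measure_eqI_generator_eq[where E = "{a \<times> b | a b. a \<in> sets pos_borel \<and> b \<in> sets pos_borel}"
        and \<Omega> = "space ?PP" and A = "\<lambda>_. space ?PP"])
    show "Int_stable {a \<times> b |a b. a \<in> sets pos_borel \<and> b \<in> sets pos_borel}"
      by (rule Int_stable_pair_measure_generator)
    show "{a \<times> b |a b. a \<in> sets pos_borel \<and> b \<in> sets pos_borel} \<subseteq> Pow (space ?PP)"
      using pair_measure_closed[of pos_borel pos_borel] by (simp add: space_pair_measure)
    show "sets J = sigma_sets (space ?PP) {a \<times> b |a b. a \<in> sets pos_borel \<and> b \<in> sets pos_borel}"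
      unfolding J_def by (simp only: sets_distr sets_pair_measure space_pair_measure)
    show "sets (?MA \<bind> N) = sigma_sets (space ?PP) {a \<times> b |a b. a \<in> sets pos_borel \<and> b \<in> sets pos_borel}"
      using sets_bind[OF sets_kernel[OF N_meas] nonempty]
      by (simp only: sets_pair_measure space_pair_measure)
    show "range (\<lambda>_. space ?PP) \<subseteq> {a \<times> b |a b. a \<in> sets pos_borel \<and> b \<in> sets pos_borel}"
      using sets.top[of pos_borel] by (auto simp: space_pair_measure)
    show "emeasure J X = emeasure (?MA \<bind> N) X"
      if "X \<in> {a \<times> b |a b. a \<in> sets pos_borel \<and> b \<in> sets pos_borel}" for X
    proof -
      from that obtain B1 B2 where X: "X = B1 \<times> B2"
        and B [measurable]: "B1 \<in> sets pos_borel" "B2 \<in> sets pos_borel" by blast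
      \<comment> \<open>The condition on the present value is absorbed into the event of the past,
        so that only the fixed set \<open>B2\<close> is left for the next value.\<close>
      have A': "A \<inter> (S n -` B1 \<inter> space M) \<in> sets (F n)"
        using A measurable_sets[OF S_measurable_F[of n n] B(1)] by auto
      have "emeasure J X = emeasure ?MA ((\<lambda>\<omega>. (S n \<omega>, S (Suc n) \<omega>)) -` X \<inter> space M)"
        unfolding J_def X by (subst emeasure_distr) auto
      also have "\<dots> = emeasure M (A \<inter> ((\<lambda>\<omega>. (S n \<omega>, S (Suc n) \<omega>)) -` X \<inter> space M))"
        unfolding X by (subst emeasure_density) (auto simp: nn_integral_indicator
            simp flip: indicator_inter_arith)
      also have "A \<inter> ((\<lambda>\<omega>. (S n \<omega>, S (Suc n) \<omega>)) -` X \<inter> space M) =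
          (A \<inter> (S n -` B1 \<inter> space M)) \<inter> S (Suc n) -` B2"
        unfolding X by auto
      also have "emeasure M \<dots> =
          (\<integral>\<^sup>+\<omega>\<in>A \<inter> (S n -` B1 \<inter> space M). emeasure (K (S n \<omega>)) B2 \<partial>M)"
        by (rule kernel_rectangle[OF A' B(2)])
      also have "\<dots> = (\<integral>\<^sup>+\<omega>. indicator A \<omega> * emeasure (N \<omega>) X \<partial>M)"
      proof (rule nn_integral_cong)
        fix \<omega> assume w: "\<omega> \<in> space M"
        have "emeasure (N \<omega>) X = emeasure (K (S n \<omega>)) ((\<lambda>y. (S n \<omega>, y)) -` X \<inter> space (K (S n \<omega>)))"
          unfolding N_def X by (rule emeasure_distr[OF pair_meas[OF w]]) auto
        also have "(\<lambda>y. (S n \<omega>, y)) -` X \<inter> space (K (S n \<omega>)) = (if S n \<omega> \<in> B1 then B2 else {})"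
          using sets.sets_into_space[of B2 "K (S n \<omega>)"] sets_K[OF S_pos[OF w]] B(2)
          unfolding X by auto
        finally show "emeasure (K (S n \<omega>)) B2 * indicator (A \<inter> (S n -` B1 \<inter> space M)) \<omega> =
            indicator A \<omega> * emeasure (N \<omega>) X"
          using w by (auto simp: indicator_def)
      qed
      also have "\<dots> = (\<integral>\<^sup>+\<omega>. emeasure (N \<omega>) X \<partial>?MA)"
        unfolding X by (subst nn_integral_density) auto
      also have "\<dots> = emeasure (?MA \<bind> N) X"
        unfolding X by (rule emeasure_bind[OF nonempty N_meas, symmetric]) auto
      finally show ?thesis .
    qed
  qed (use fin in auto)
  have "(\<integral>\<^sup>+\<omega>\<in>A. f (S n \<omega>, S (Suc n) \<omega>) \<partial>M) = (\<integral>\<^sup>+z. f z \<partial>J)"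
    unfolding J_def by (subst nn_integral_distr) (auto simp: nn_integral_density mult.commute)
  also have "\<dots> = (\<integral>\<^sup>+\<omega>. (\<integral>\<^sup>+z. f z \<partial>N \<omega>) \<partial>?MA)"
    unfolding \<open>J = ?MA \<bind> N\<close> by (rule nn_integral_bind[OF f N_meas])
  also have "\<dots> = (\<integral>\<^sup>+\<omega>\<in>A. (\<integral>\<^sup>+z. f z \<partial>N \<omega>) \<partial>M)"
    by (subst nn_integral_density) (auto simp: mult.commute intro!: nn_integral_measurable_subprob_algebra2)
  also have "\<dots> = (\<integral>\<^sup>+\<omega>\<in>A. (\<integral>\<^sup>+y. f (S n \<omega>, y) \<partial>K (S n \<omega>)) \<partial>M)"
    unfolding N_def using pair_meas by (intro nn_integral_cong) (simp add: nn_integral_distr)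
  finally show ?thesis .
qed

section \<open>One-step means and drop events\<close>

lemma space_kernel: "0 < y \<Longrightarrow> space (K y) = {0<..}"
  using sets_eq_imp_space_eq[OF sets_K] by (simp add: space_restrict_space)

lemma pos_borel_ident [measurable]: "(\<lambda>y. y) \<in> borel_measurable pos_borel"
  by (rule measurable_restrict_space1) simp

lemma fst_snd_pos_borel [measurable]:
  "fst \<in> borel_measurable (pos_borel \<Otimes>\<^sub>M pos_borel)"
  "snd \<in> borel_measurable (pos_borel \<Otimes>\<^sub>M pos_borel)"
  by (rule measurable_compose[OF measurable_fst pos_borel_ident])
     (rule measurable_compose[OF measurable_snd pos_borel_ident])

lemma Ioo_kernel: "0 < y \<Longrightarrow> {0<..<z} \<in> sets (K y)"
  by (auto simp: sets_K sets_restrict_space_iff)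

lemma kernel_mean:
  assumes "0 < y"
  shows "(\<integral>\<^sup>+z. ennreal z \<partial>K y) = ennreal y"
proof -
  have "has_bochner_integral (K y) (\<lambda>z. z) y"
    using kernel assms by (simp add: martingale_kernel_def)
  then have "integrable (K y) (\<lambda>z. z)" "(\<integral>z. z \<partial>K y) = y"
    by (auto simp: has_bochner_integral_iff)
  moreover have "AE z in K y. 0 \<le> z"
    by (rule AE_I2) (simp add: space_kernel assms)
  ultimately show ?thesis by (simp add: nn_integral_eq_integral)
qed

text \<open>The factor \<open>y\<close> undoes the normalisation in \<open>drop_mean\<close>. What
  remains is the expected next value on a drop, which is the quantity that the second hypothesis of
  the theorem bounds.\<close>

lemma kernel_drop_mean:
  assumes "0 < y"
  shows "(\<integral>\<^sup>+z. ennreal (if z < y then z else 0) \<partial>K y) = ennreal (y * drop_mean K y)"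
proof -
  have "has_bochner_integral (K y) (\<lambda>z. z) y"
    using kernel assms by (simp add: martingale_kernel_def)
  then have "integrable (K y) (\<lambda>z. indicator {0<..<y} z *\<^sub>R z)"
    using Ioo_kernel[OF assms] by (intro integrable_mult_indicator) (auto simp: has_bochner_integral_iff)
  then have "(\<integral>\<^sup>+z. ennreal (indicator {0<..<y} z *\<^sub>R z) \<partial>K y) =
      ennreal (\<integral>z. indicator {0<..<y} z *\<^sub>R z \<partial>K y)"
    by (rule nn_integral_eq_integral) (auto simp: indicator_def)
  moreover have "(\<integral>\<^sup>+z. ennreal (if z < y then z else 0) \<partial>K y) =
      (\<integral>\<^sup>+z. ennreal (indicator {0<..<y} z *\<^sub>R z) \<partial>K y)"
    by (rule nn_integral_cong) (auto simp: indicator_def space_kernel assms)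
  moreover have "y * drop_mean K y = (\<integral>z. indicator {0<..<y} z *\<^sub>R z \<partial>K y)"
    using assms by (simp add: drop_mean_def set_lebesgue_integral_def)
  ultimately show ?thesis by simp
qed

lemma martingale_step:
  assumes "A \<in> sets (F n)"
  shows "(\<integral>\<^sup>+\<omega>\<in>A. ennreal (S (Suc n) \<omega>) \<partial>M) = (\<integral>\<^sup>+\<omega>\<in>A. ennreal (S n \<omega>) \<partial>M)"
proof -
  have "(\<integral>\<^sup>+\<omega>\<in>A. ennreal (S (Suc n) \<omega>) \<partial>M) =
      (\<integral>\<^sup>+\<omega>\<in>A. (\<integral>\<^sup>+y. ennreal y \<partial>K (S n \<omega>)) \<partial>M)"
    using one_step[OF assms, of "\<lambda>z. ennreal (snd z)"] by simp
  also have "\<dots> = (\<integral>\<^sup>+\<omega>\<in>A. ennreal (S n \<omega>) \<partial>M)"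
    by (rule nn_integral_cong) (simp add: kernel_mean S_pos)
  finally show ?thesis .
qed

lemma nn_integral_S: "(\<integral>\<^sup>+\<omega>. ennreal (S n \<omega>) \<partial>M) = ennreal x"
proof (induction n)
  case 0
  have "(\<integral>\<^sup>+\<omega>. ennreal (S 0 \<omega>) \<partial>M) = (\<integral>\<^sup>+\<omega>. ennreal x \<partial>M)"
    using chain by (intro nn_integral_cong_AE) (auto simp: markov_chain_from_def)
  then show ?case by (simp add: emeasure_space_1)
next
  case (Suc n)
  have "space M \<in> sets (F n)" using sets.top[of "F n"] by simp
  from martingale_step[OF this] Suc show ?case
    by (simp cong: nn_integral_cong)
qed

lemma integrable_S: "integrable M (S n)"
  using S_pos by (intro integrableI_nonneg) (auto simp: nn_integral_S less_imp_le)

lemma set_integrable_S: "A \<in> sets M \<Longrightarrow> set_integrable M A (S n)"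
  unfolding set_integrable_def by (intro integrable_mult_indicator integrable_S)

text \<open>Identities for the kernel use nonnegative integrals, which presuppose no integrability,
  while the excess over a level is a difference of real integrals. This is the bridge between the
  two.\<close>

lemma set_nn_integral_S:
  assumes "A \<in> sets M"
  shows "(\<integral>\<^sup>+\<omega>\<in>A. ennreal (S n \<omega>) \<partial>M) = ennreal (LINT \<omega>:A|M. S n \<omega>)"
proof -
  have "(\<integral>\<^sup>+\<omega>\<in>A. ennreal (S n \<omega>) \<partial>M) = (\<integral>\<^sup>+\<omega>. ennreal (indicator A \<omega> *\<^sub>R S n \<omega>) \<partial>M)"
    by (rule nn_integral_cong) (auto simp: indicator_def)
  also have "\<dots> = ennreal (LINT \<omega>:A|M. S n \<omega>)"
    unfolding set_lebesgue_integral_def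
    using set_integrable_S[OF assms] S_pos
    by (intro nn_integral_eq_integral) (auto simp: set_integrable_def indicator_def less_imp_le)
  finally show ?thesis .
qed

lemma set_integral_S_nonneg: "0 \<le> (LINT \<omega>:A|M. S n \<omega>)"
  unfolding set_lebesgue_integral_def
  by (rule Bochner_Integration.integral_nonneg) (auto simp: indicator_def S_pos less_imp_le)

text \<open>Indexed by the time just before the drop, so that the part of an event of
  \<open>F n\<close> in \<open>D n\<close> is evaluated by a single application of the kernel. The
  set itself belongs to \<open>F (Suc n)\<close>.\<close>

abbreviation D :: "nat \<Rightarrow> 'a set" where
  "D n \<equiv> {\<omega> \<in> space M. S (Suc n) \<omega> < S n \<omega>}"

lemma D_measurable [measurable]: "D n \<in> sets M"
  by (rule sets_F_imp_sets_M[OF drop_in_F])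

lemma drop_prob_step:
  assumes "A \<in> sets (F n)"
  shows "emeasure M (A \<inter> D n) = (\<integral>\<^sup>+\<omega>\<in>A. ennreal (drop_prob K (S n \<omega>)) \<partial>M)"
proof -
  have [measurable]: "A \<in> sets M" using assms by (rule sets_F_imp_sets_M)
  have "emeasure M (A \<inter> D n) = (\<integral>\<^sup>+\<omega>\<in>A. (if S (Suc n) \<omega> < S n \<omega> then 1 else 0) \<partial>M)"
  proof -
    have "emeasure M (A \<inter> D n) = (\<integral>\<^sup>+\<omega>. indicator (A \<inter> D n) \<omega> \<partial>M)" by simp
    also have "\<dots> = (\<integral>\<^sup>+\<omega>\<in>A. (if S (Suc n) \<omega> < S n \<omega> then 1 else 0) \<partial>M)"
      by (rule nn_integral_cong) (auto simp: indicator_def)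
    finally show ?thesis .
  qed
  also have "\<dots> = (\<integral>\<^sup>+\<omega>\<in>A. (\<integral>\<^sup>+y. (if y < S n \<omega> then 1 else 0) \<partial>K (S n \<omega>)) \<partial>M)"
    using one_step[OF assms, of "\<lambda>z. if snd z < fst z then 1 else 0"] by simp
  also have "\<dots> = (\<integral>\<^sup>+\<omega>\<in>A. ennreal (drop_prob K (S n \<omega>)) \<partial>M)"
  proof (intro nn_integral_cong arg_cong2[where f = "(*)"] refl)
    fix \<omega> assume "\<omega> \<in> space M"
    then have pos: "0 < S n \<omega>" by (rule S_pos)
    have "(\<integral>\<^sup>+y. (if y < S n \<omega> then 1 else 0) \<partial>K (S n \<omega>)) =
        (\<integral>\<^sup>+y. indicator {0<..<S n \<omega>} y \<partial>K (S n \<omega>))"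
      by (rule nn_integral_cong) (simp add: indicator_def space_kernel pos)
    also have "\<dots> = ennreal (drop_prob K (S n \<omega>))"
      using Ioo_kernel[OF pos] kernel_prob_space[OF pos]
      by (simp add: drop_prob_def finite_measure.emeasure_eq_measure prob_space.finite_measure)
    finally show "(\<integral>\<^sup>+y. (if y < S n \<omega> then 1 else 0) \<partial>K (S n \<omega>)) =
        ennreal (drop_prob K (S n \<omega>))" .
  qed
  finally show ?thesis .
qed

lemma drop_mean_step:
  assumes "A \<in> sets (F n)"
  shows "(\<integral>\<^sup>+\<omega>\<in>A \<inter> D n. ennreal (S (Suc n) \<omega>) \<partial>M) =
    (\<integral>\<^sup>+\<omega>\<in>A. ennreal (S n \<omega> * drop_mean K (S n \<omega>)) \<partial>M)"
proof -
  have "(\<integral>\<^sup>+\<omega>\<in>A \<inter> D n. ennreal (S (Suc n) \<omega>) \<partial>M) =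
      (\<integral>\<^sup>+\<omega>\<in>A. ennreal (if S (Suc n) \<omega> < S n \<omega> then S (Suc n) \<omega> else 0) \<partial>M)"
    by (rule nn_integral_cong) (auto simp: indicator_def)
  also have "\<dots> = (\<integral>\<^sup>+\<omega>\<in>A. (\<integral>\<^sup>+y. ennreal (if y < S n \<omega> then y else 0) \<partial>K (S n \<omega>)) \<partial>M)"
    using one_step[OF assms, of "\<lambda>z. ennreal (if snd z < fst z then snd z else 0)"]
    by (simp cong: if_cong)
  also have "\<dots> = (\<integral>\<^sup>+\<omega>\<in>A. ennreal (S n \<omega> * drop_mean K (S n \<omega>)) \<partial>M)"
    by (rule nn_integral_cong) (simp add: kernel_drop_mean S_pos)
  finally show ?thesis .
qed

section \<open>Drop times as stopping times\<close>

text \<open>Infima of nonempty sets in \<open>enat\<close> are attained, and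
  \<open>j = Suc i\<close> turns the strict \<open>\<tau> < j\<close> into
  \<open>\<tau> \<le> i\<close>. This recursion between sublevel sets drives every later induction
  on \<open>k\<close>.\<close>

lemma drop_time_Suc_le_iff:
  "drop_time S (Suc k) \<omega> \<le> enat n \<longleftrightarrow> (\<exists>i<n. drop_time S k \<omega> \<le> enat i \<and> S (Suc i) \<omega> < S i \<omega>)"
proof -
  let ?J = "{enat j | j. drop_time S k \<omega> < enat j \<and> S j \<omega> < S (j - 1) \<omega>}"
  have lt_iff: "drop_time S k \<omega> < enat (Suc i) \<longleftrightarrow> drop_time S k \<omega> \<le> enat i" for i
    by (cases "drop_time S k \<omega>") auto
  have "Inf ?J \<le> enat n \<longleftrightarrow> (\<exists>a\<in>?J. a \<le> enat n)"
  proof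
    assume le: "Inf ?J \<le> enat n"
    show "\<exists>a\<in>?J. a \<le> enat n"
    proof (rule ccontr)
      assume "\<not> ?thesis"
      then have "enat (Suc n) \<le> Inf ?J"
        by (intro Inf_greatest) (auto simp: not_le Suc_le_eq)
      from this le have "enat (Suc n) \<le> enat n" by (rule order_trans)
      then show False by simp
    qed
  qed (auto intro: Inf_lower2)
  also have "\<dots> \<longleftrightarrow> (\<exists>j\<le>n. drop_time S k \<omega> < enat j \<and> S j \<omega> < S (j - 1) \<omega>)"
    by auto
  also have "\<dots> \<longleftrightarrow> (\<exists>i<n. drop_time S k \<omega> \<le> enat i \<and> S (Suc i) \<omega> < S i \<omega>)"
  proof safe
    fix j assume "j \<le> n" "drop_time S k \<omega> < enat j" "S j \<omega> < S (j - 1) \<omega>"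
    then show "\<exists>i<n. drop_time S k \<omega> \<le> enat i \<and> S (Suc i) \<omega> < S i \<omega>"
      \<comment> \<open>\<open>j = 0\<close> cannot occur, since nothing in \<open>enat\<close> lies
        strictly below 0; so the truncated \<open>j - 1\<close> is always the true
        predecessor.\<close>
      by (cases j) (auto simp: lt_iff Suc_le_eq simp flip: zero_enat_def)
  next
    fix i assume "i < n" "drop_time S k \<omega> \<le> enat i" "S (Suc i) \<omega> < S i \<omega>"
    then show "\<exists>j\<le>n. drop_time S k \<omega> < enat j \<and> S j \<omega> < S (j - 1) \<omega>"
      by (intro exI[of _ "Suc i"]) (auto simp: lt_iff)
  qed
  finally show ?thesis by simp
qed

text \<open>Consecutive drop times differ by at least one. Hence the drop that completes
  \<open>drop_time S (Suc j)\<close> occurs in a step starting at time \<open>j\<close> or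
  later.\<close>

lemma drop_time_le_imp_le: "drop_time S k \<omega> \<le> enat n \<Longrightarrow> k \<le> n"
proof (induction k arbitrary: n)
  case (Suc k)
  then show ?case unfolding drop_time_Suc_le_iff by fastforce
qed simp

lemma drop_time_stopping: "{\<omega> \<in> space M. drop_time S k \<omega> \<le> enat n} \<in> sets (F n)"
proof (induction k arbitrary: n)
  case 0
  then show ?case using sets.top[of "F n"] by simp
next
  case (Suc k)
  have "{\<omega> \<in> space M. drop_time S (Suc k) \<omega> \<le> enat n} =
      (\<Union>i<n. {\<omega> \<in> space M. drop_time S k \<omega> \<le> enat i} \<inter> D i)"
    unfolding drop_time_Suc_le_iff by auto
  moreover have "{\<omega> \<in> space M. drop_time S k \<omega> \<le> enat i} \<inter> D i \<in> sets (F n)" if "i < n" for i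
    using that sets_F_mono[OF _ Suc.IH, of i n] sets_F_mono[OF _ drop_in_F, of i n] by auto
  ultimately show ?case by auto
qed

text \<open>
  Optional stopping at a bounded time needs no limit theorem, and by induction it also gives
  measurability of the stopped value without referring to the limit on \<open>{\<tau> = \<infinity>}\<close>.
\<close>
lemma drop_time_optional_stopping:
  fixes k n :: nat
  defines "B \<equiv> \<lambda>n. {\<omega> \<in> space M. drop_time S k \<omega> \<le> enat n}"
  shows "(\<lambda>\<omega>. ennreal (value_at S (drop_time S k) \<omega>) * indicator (B n) \<omega>) \<in> borel_measurable M" (is ?meas)
    and "(\<integral>\<^sup>+\<omega>\<in>B n. ennreal (value_at S (drop_time S k) \<omega>) \<partial>M) +
      (\<integral>\<^sup>+\<omega>\<in>space M - B n. ennreal (S n \<omega>) \<partial>M) = ennreal x" (is ?eq)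
proof -
  let ?v = "\<lambda>\<omega>. ennreal (value_at S (drop_time S k) \<omega>)"
  have B_F: "B n \<in> sets (F n)" for n
    unfolding B_def by (rule drop_time_stopping)
  have [measurable]: "B n \<in> sets M" for n
    using B_F by (rule sets_F_imp_sets_M)
  have "?meas \<and> ?eq"
  proof (induction n)
    case 0
    have v0: "?v \<omega> * indicator (B 0) \<omega> = ennreal (S 0 \<omega>) * indicator (B 0) \<omega>" for \<omega>
      by (cases "drop_time S k \<omega>") (auto simp: B_def value_at_def indicator_def)
    have "(\<integral>\<^sup>+\<omega>. (ennreal (S 0 \<omega>) * indicator (B 0) \<omega> +
        ennreal (S 0 \<omega>) * indicator (space M - B 0) \<omega>) \<partial>M) = (\<integral>\<^sup>+\<omega>. ennreal (S 0 \<omega>) \<partial>M)"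
      by (rule nn_integral_cong) (auto simp: indicator_def)
    then show ?case
      unfolding v0 by (simp add: nn_integral_add nn_integral_S)
  next
    case (Suc n)
    then have meas [measurable]: "(\<lambda>\<omega>. ?v \<omega> * indicator (B n) \<omega>) \<in> borel_measurable M"
      and eq: "(\<integral>\<^sup>+\<omega>\<in>B n. ?v \<omega> \<partial>M) + (\<integral>\<^sup>+\<omega>\<in>space M - B n. ennreal (S n \<omega>) \<partial>M) = ennreal x"
      by auto
    \<comment> \<open>On \<open>B (Suc n) - B n\<close> the drop time is exactly
      \<open>Suc n\<close>. Only values of the chain enter, and measurability passes from
      \<open>n\<close> to \<open>Suc n\<close>.\<close>
    have vS: "?v \<omega> * indicator (B (Suc n)) \<omega> =
        ?v \<omega> * indicator (B n) \<omega> + ennreal (S (Suc n) \<omega>) * indicator (B (Suc n) - B n) \<omega>" for \<omega>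
      by (cases "drop_time S k \<omega>") (auto simp: B_def value_at_def indicator_def le_Suc_eq)
    have "(\<integral>\<^sup>+\<omega>\<in>B (Suc n). ?v \<omega> \<partial>M) + (\<integral>\<^sup>+\<omega>\<in>space M - B (Suc n). ennreal (S (Suc n) \<omega>) \<partial>M) =
        (\<integral>\<^sup>+\<omega>\<in>B n. ?v \<omega> \<partial>M) + ((\<integral>\<^sup>+\<omega>\<in>B (Suc n) - B n. ennreal (S (Suc n) \<omega>) \<partial>M) +
        (\<integral>\<^sup>+\<omega>\<in>space M - B (Suc n). ennreal (S (Suc n) \<omega>) \<partial>M))"
      unfolding vS by (simp add: nn_integral_add add.assoc)
    also have "(\<integral>\<^sup>+\<omega>\<in>B (Suc n) - B n. ennreal (S (Suc n) \<omega>) \<partial>M) +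
        (\<integral>\<^sup>+\<omega>\<in>space M - B (Suc n). ennreal (S (Suc n) \<omega>) \<partial>M) =
        (\<integral>\<^sup>+\<omega>\<in>space M - B n. ennreal (S (Suc n) \<omega>) \<partial>M)"
    proof (subst nn_integral_add[symmetric])
      have "B n \<subseteq> B (Suc n)" by (auto simp: B_def elim!: order_trans)
      then show "(\<integral>\<^sup>+\<omega>. ennreal (S (Suc n) \<omega>) * indicator (B (Suc n) - B n) \<omega> +
          ennreal (S (Suc n) \<omega>) * indicator (space M - B (Suc n)) \<omega> \<partial>M) =
          (\<integral>\<^sup>+\<omega>\<in>space M - B n. ennreal (S (Suc n) \<omega>) \<partial>M)"
        by (intro nn_integral_cong) (auto simp: indicator_def)
    qed measurable
    \<comment> \<open>Not having stopped by time \<open>n\<close> is an event of \<open>F n\<close>,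
      so going back from \<open>S (Suc n)\<close> to \<open>S n\<close> on it preserves the
      mean.\<close>
    also have "\<dots> = (\<integral>\<^sup>+\<omega>\<in>space M - B n. ennreal (S n \<omega>) \<partial>M)"
      using sets.compl_sets[OF B_F, of n] by (intro martingale_step) simp
    finally have "(\<integral>\<^sup>+\<omega>\<in>B (Suc n). ?v \<omega> \<partial>M) +
        (\<integral>\<^sup>+\<omega>\<in>space M - B (Suc n). ennreal (S (Suc n) \<omega>) \<partial>M) = ennreal x"
      unfolding eq .
    then show ?case unfolding vS by (rule conjI[rotated]) measurable
  qed
  then show ?meas ?eq by auto
qed

end

section \<open>One-step consequences of the uniform bounds\<close>

locale dropping_martingale_chain = martingale_chain +
  fixes c C :: real
  assumes c_pos: "0 < c"
    and drop_prob_ge: "\<And>y. 0 < y \<Longrightarrow> c \<le> drop_prob K y"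
    and drop_mean_le: "\<And>y. 0 < y \<Longrightarrow> y * drop_mean K y \<le> C"
begin

lemma c_le_1: "c \<le> 1"
  using drop_prob_ge[of 1] kernel_prob_space[of 1]
  by (auto simp: drop_prob_def intro: order_trans prob_space.prob_le_1)

lemma C_nonneg: "0 \<le> C"
proof -
  have "0 \<le> drop_mean K 1"
    unfolding drop_mean_def set_lebesgue_integral_def
    by (rule Bochner_Integration.integral_nonneg) (auto simp: indicator_def)
  with drop_mean_le[of 1] show ?thesis by simp
qed

lemma prob_drop_ge:
  assumes "A \<in> sets (F n)"
  shows "c * prob A \<le> prob (A \<inter> D n)"
proof -
  have [measurable]: "A \<in> sets M" using assms by (rule sets_F_imp_sets_M)
  have "ennreal (c * prob A) = (\<integral>\<^sup>+\<omega>\<in>A. ennreal c \<partial>M)"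
    using c_pos by (simp add: nn_integral_cmult_indicator emeasure_eq_measure ennreal_mult)
  also have "\<dots> \<le> (\<integral>\<^sup>+\<omega>\<in>A. ennreal (drop_prob K (S n \<omega>)) \<partial>M)"
    by (intro nn_integral_mono mult_right_mono ennreal_leI drop_prob_ge S_pos) auto
  also have "\<dots> = ennreal (prob (A \<inter> D n))"
    using drop_prob_step[OF assms] by (simp add: emeasure_eq_measure)
  finally show ?thesis by simp
qed

text \<open>Whatever the current level, the expected value after a drop contributes at most
  \<open>C\<close>. The mean removed with the drops is thus controlled by the probability of
  \<open>A\<close> alone, even where the chain is large.\<close>

lemma set_integral_drop_le:
  assumes "A \<in> sets (F n)"
  shows "(LINT \<omega>:A \<inter> D n|M. S (Suc n) \<omega>) \<le> C * prob A"
proof -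
  have [measurable]: "A \<in> sets M" using assms by (rule sets_F_imp_sets_M)
  have "ennreal (LINT \<omega>:A \<inter> D n|M. S (Suc n) \<omega>) =
      (\<integral>\<^sup>+\<omega>\<in>A. ennreal (S n \<omega> * drop_mean K (S n \<omega>)) \<partial>M)"
    using drop_mean_step[OF assms] by (simp add: set_nn_integral_S)
  also have "\<dots> \<le> (\<integral>\<^sup>+\<omega>\<in>A. ennreal C \<partial>M)"
    by (intro nn_integral_mono mult_right_mono ennreal_leI drop_mean_le S_pos) auto
  also have "\<dots> = ennreal (C * prob A)"
    using C_nonneg by (simp add: nn_integral_cmult_indicator emeasure_eq_measure ennreal_mult)
  finally show ?thesis using C_nonneg by (simp add: ennreal_le_iff)
qed

text \<open>The mean over \<open>A\<close> is unchanged by the step. Discarding the drop costs at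
  most \<open>C * prob A\<close> of it, while the subtracted term shrinks by at least
  \<open>C / c * (c * prob A)\<close>; the level \<open>C / c\<close> is chosen so that the two
  balance.\<close>

lemma excess_step:
  assumes "A \<in> sets (F n)"
  shows "(LINT \<omega>:A|M. S n \<omega>) - C / c * prob A \<le>
    (LINT \<omega>:A - D n|M. S (Suc n) \<omega>) - C / c * prob (A - D n)"
proof -
  have A [measurable]: "A \<in> sets M" using assms by (rule sets_F_imp_sets_M)
  have "(LINT \<omega>:A|M. S n \<omega>) = (LINT \<omega>:A|M. S (Suc n) \<omega>)"
    using martingale_step[OF assms] A
    by (simp add: set_nn_integral_S set_integral_S_nonneg)
  also have "\<dots> = (LINT \<omega>:(A \<inter> D n) \<union> (A - D n)|M. S (Suc n) \<omega>)"
    by (simp add: Int_Diff_Un)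
  also have "\<dots> = (LINT \<omega>:A \<inter> D n|M. S (Suc n) \<omega>) + (LINT \<omega>:A - D n|M. S (Suc n) \<omega>)"
    by (intro set_integral_Un set_integrable_S) auto
  finally have mean: "(LINT \<omega>:A|M. S n \<omega>) \<le> C * prob A + (LINT \<omega>:A - D n|M. S (Suc n) \<omega>)"
    using set_integral_drop_le[OF assms] by simp
  have "prob (A - D n) \<le> (1 - c) * prob A"
    using prob_drop_ge[OF assms] by (simp add: finite_measure_Diff' algebra_simps)
  then have "C / c * prob (A - D n) \<le> C / c * ((1 - c) * prob A)"
    using C_nonneg c_pos by (intro mult_left_mono) auto
  also have "\<dots> = C / c * prob A - C * prob A"
    using c_pos by (simp add: field_simps)
  finally show ?thesis using mean by simp
qed

section \<open>Paths without a drop after a given time\<close>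

lemma survival_measurable:
  assumes "A \<in> sets (F j)"
  shows "A - (\<Union>m<i. D (j + m)) \<in> sets (F (j + i))"
proof -
  have "D (j + m) \<in> sets (F (j + i))" if "m < i" for m
    using that by (intro sets_F_mono[OF _ drop_in_F]) auto
  with sets_F_mono[OF le_add1 assms] show ?thesis by auto
qed

lemma survival_Suc:
  "A - (\<Union>m<Suc i. D (j + m)) = (A - (\<Union>m<i. D (j + m))) - D (j + i)"
  by (auto simp: less_Suc_eq)

text \<open>Iteration of \<open>excess_step\<close>. The left-hand side does not depend on
  \<open>i\<close>: the surviving paths keep a fixed amount of excess although their probability
  decays geometrically.\<close>

lemma excess_survival:
  assumes "A \<in> sets (F j)"
  shows "(LINT \<omega>:A|M. S j \<omega>) - C / c * prob A \<le>
    (LINT \<omega>:A - (\<Union>m<i. D (j + m))|M. S (j + i) \<omega>) - C / c * prob (A - (\<Union>m<i. D (j + m)))"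
proof (induction i)
  case (Suc i)
  also note excess_step[OF survival_measurable[OF assms]]
  finally show ?case by (simp only: survival_Suc add_Suc_right)
qed simp

lemma prob_survival_le: "prob (space M - (\<Union>m<i. D (j + m))) \<le> (1 - c) ^ i"
proof (induction i)
  case 0
  then show ?case by (simp add: prob_space)
next
  case (Suc i)
  let ?A = "space M - (\<Union>m<i. D (j + m))"
  have A: "?A \<in> sets (F (j + i))"
    using sets.top[of "F j"] by (intro survival_measurable) simp
  have "prob (?A - D (j + i)) \<le> (1 - c) * prob ?A"
    using prob_drop_ge[OF A] sets_F_imp_sets_M[OF A]
    by (simp add: finite_measure_Diff' algebra_simps)
  also have "\<dots> \<le> (1 - c) * (1 - c) ^ i"
    using Suc c_le_1 by (intro mult_left_mono) auto
  finally show ?case by (simp only: survival_Suc power_Suc)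
qed

lemma AE_drop_after: "AE \<omega> in M. \<exists>m\<ge>j. S (Suc m) \<omega> < S m \<omega>"
proof -
  let ?N = "space M - (\<Union>m. D (j + m))"
  have "prob ?N \<le> (1 - c) ^ i" for i
    by (rule order_trans[OF finite_measure_mono prob_survival_le[where j = j]]) auto
  moreover have "(\<lambda>i. (1 - c) ^ i) \<longlonglongrightarrow> 0"
    using c_pos c_le_1 by (intro LIMSEQ_realpow_zero) auto
  ultimately have "prob ?N \<le> 0"
    by (intro LIMSEQ_le_const) auto
  then have "?N \<in> null_sets M"
    by (auto simp: null_sets_def emeasure_eq_measure measure_le_0_iff)
  then show ?thesis
    by (rule AE_I') (use le_add1 in blast)
qed

text \<open>Almost every path drops after every time, so each drop time is followed by a further
  one. Consequently the events that the drop time is at most \<open>n\<close> exhaust the space up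
  to a null set.\<close>

lemma AE_drop_time_finite: "AE \<omega> in M. \<exists>n. drop_time S k \<omega> \<le> enat n"
proof -
  have "AE \<omega> in M. \<forall>j. \<exists>m\<ge>j. S (Suc m) \<omega> < S m \<omega>"
    by (simp add: AE_all_countable AE_drop_after)
  then show ?thesis
  proof eventually_elim
    case (elim \<omega>)
    show ?case
    proof (induction k)
      case (Suc k)
      then obtain n where n: "drop_time S k \<omega> \<le> enat n" by blast
      obtain m where "n \<le> m" "S (Suc m) \<omega> < S m \<omega>" using elim by blast
      with n show ?case
        unfolding drop_time_Suc_le_iff by (meson enat_ord_simps(1) lessI order_trans)
    qed simp
  qed
qed

section \<open>Loss of mean at a drop time of an unbounded chain\<close>

lemma bubble_if_unbounded:
  assumes x: "0 < x" and unb: "\<not> as_bounded M S"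
  shows "bubble M S"
proof -
  let ?L = "C / c"
  \<comment> \<open>\<open>C / c\<close> in particular is not an almost sure bound. There are
    countably many times, so a single one already exceeds it with positive probability.\<close>
  obtain j where j: "\<not> (AE \<omega> in M. S j \<omega> \<le> ?L)"
    using unb by (auto simp: as_bounded_def AE_all_countable)
  define A where "A = {\<omega> \<in> space M. ?L < S j \<omega>}"
  have A_F: "A \<in> sets (F j)"
  proof -
    have [measurable]: "S j \<in> borel_measurable (F j)" by (simp add: S_borel_measurable_F)
    have "{\<omega> \<in> space (F j). ?L < S j \<omega>} \<in> sets (F j)" by measurable
    then show ?thesis by (simp add: A_def)
  qed
  then have A_M [measurable]: "A \<in> sets M" by (rule sets_F_imp_sets_M)
  define \<delta> where "\<delta> = (LINT \<omega>:A|M. S j \<omega>) - ?L * prob A"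
  have \<delta>_pos: "0 < \<delta>"
  proof -
    \<comment> \<open>On the space, \<open>?g\<close> is the positive part of
      \<open>S j - C / c\<close>. A vanishing integral would make it zero almost surely, against the
      choice of \<open>j\<close>.\<close>
    let ?g = "\<lambda>\<omega>. indicator A \<omega> * S j \<omega> - ?L * indicator A \<omega>"
    have int: "integrable M (\<lambda>\<omega>. indicator A \<omega> * S j \<omega>)"
      using set_integrable_S[OF A_M, of j] by (simp add: set_integrable_def)
    have int': "integrable M (\<lambda>\<omega>. ?L * indicator A \<omega>)"
      by (intro integrable_mult_right integrable_real_indicator) (auto simp: emeasure_eq_measure)
    have g_nonneg: "AE \<omega> in M. 0 \<le> ?g \<omega>"
      by (rule AE_I2) (auto simp: A_def indicator_def)
    have "\<delta> = (\<integral>\<omega>. ?g \<omega> \<partial>M)"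
      unfolding \<delta>_def set_lebesgue_integral_def using int int' A_M sets.sets_into_space[OF A_M]
      by (simp add: Int_absorb2)
    moreover have "(\<integral>\<omega>. ?g \<omega> \<partial>M) \<noteq> 0"
    proof
      assume "(\<integral>\<omega>. ?g \<omega> \<partial>M) = 0"
      then have "AE \<omega> in M. ?g \<omega> = 0"
        using integral_nonneg_eq_0_iff_AE[OF Bochner_Integration.integrable_diff[OF int int'] g_nonneg]
        by simp
      then have "AE \<omega> in M. S j \<omega> \<le> ?L"
        by (rule AE_mp) (auto simp: A_def indicator_def split: if_splits)
      with j show False ..
    qed
    moreover have "0 \<le> (\<integral>\<omega>. ?g \<omega> \<partial>M)"
      using g_nonneg by (rule integral_nonneg_AE)
    ultimately show ?thesis by simp
  qed
  text \<open>At most \<open>j\<close> drops have occurred by time \<open>j\<close>, so without a drop after \<open>j\<close> the time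
    \<open>\<tau>\<^bsub>j+1\<^esub>\<close> has not yet come.\<close>
  let ?T = "drop_time S (Suc j)"
  let ?v = "\<lambda>\<omega>. ennreal (value_at S ?T \<omega>)"
  define B where "B n = {\<omega> \<in> space M. ?T \<omega> \<le> enat n}" for n
  have B_M [measurable]: "B n \<in> sets M" for n
    unfolding B_def by (rule sets_F_imp_sets_M[OF drop_time_stopping])
  have B_mono: "B m \<subseteq> B n" if "m \<le> n" for m n
  proof
    fix \<omega> assume "\<omega> \<in> B m"
    then have "\<omega> \<in> space M" "?T \<omega> \<le> enat m" unfolding B_def by blast+
    moreover from this(2) have "?T \<omega> \<le> enat n" by (rule order_trans) (simp add: that)
    ultimately show "\<omega> \<in> B n" unfolding B_def by blast
  qed
  have survival_sub: "A - (\<Union>m<i. D (j + m)) \<subseteq> space M - B (j + i)" for i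
  proof safe
    fix \<omega> assume "\<omega> \<in> A" "\<omega> \<notin> (\<Union>m<i. D (j + m))" "\<omega> \<in> B (j + i)"
    then obtain n where "n < j + i" "drop_time S j \<omega> \<le> enat n" "S (Suc n) \<omega> < S n \<omega>"
      unfolding B_def drop_time_Suc_le_iff by auto
    moreover from this have "j \<le> n" by (auto dest: drop_time_le_imp_le)
    ultimately have "\<omega> \<in> D (j + (n - j))" "n - j < i"
      using \<open>\<omega> \<in> A\<close> by (auto simp: A_def)
    with \<open>\<omega> \<notin> (\<Union>m<i. D (j + m))\<close> show False by blast
  qed (auto simp: A_def)
  have lost: "ennreal \<delta> \<le> (\<integral>\<^sup>+\<omega>\<in>space M - B (j + i). ennreal (S (j + i) \<omega>) \<partial>M)" for i
  proof -
    let ?U = "A - (\<Union>m<i. D (j + m))"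
    \<comment> \<open>The term subtracted in \<open>excess_survival\<close> is nonnegative, so the
      integral over the surviving paths alone is at least \<open>\<delta>\<close>.\<close>
    have "0 \<le> ?L * prob ?U" using C_nonneg c_pos by simp
    then have "\<delta> \<le> (LINT \<omega>:?U|M. S (j + i) \<omega>)"
      using excess_survival[OF A_F, of i] unfolding \<delta>_def by linarith
    then have "ennreal \<delta> \<le> (\<integral>\<^sup>+\<omega>\<in>?U. ennreal (S (j + i) \<omega>) \<partial>M)"
      by (subst set_nn_integral_S) (auto intro: ennreal_leI)
    also have "\<dots> \<le> (\<integral>\<^sup>+\<omega>\<in>space M - B (j + i). ennreal (S (j + i) \<omega>) \<partial>M)"
      using survival_sub by (intro nn_integral_mono mult_left_mono) (auto simp: indicator_def)
    finally show ?thesis .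
  qed
  \<comment> \<open>Cancellation in \<open>ennreal\<close>: the premise excludes an infinite
    \<open>a\<close> and forces \<open>\<delta> \<le> x\<close>, so
    \<open>ennreal (x - \<delta>)\<close> is not truncated at 0.\<close>
  have cancel: "a \<le> ennreal (x - \<delta>)" if "a + ennreal \<delta> \<le> ennreal x" for a
    using that \<delta>_pos x by (cases a) (auto simp: top_unique simp flip: ennreal_plus)
  have stopped_le: "(\<integral>\<^sup>+\<omega>\<in>B n. ?v \<omega> \<partial>M) \<le> ennreal (x - \<delta>)" for n
  proof -
    \<comment> \<open>The loss \<open>\<delta>\<close> is known only at times \<open>j + i\<close>,
      so \<open>B n\<close> is first enlarged to \<open>B (j + n)\<close>.\<close>
    have "(\<integral>\<^sup>+\<omega>\<in>B n. ?v \<omega> \<partial>M) \<le> (\<integral>\<^sup>+\<omega>\<in>B (j + n). ?v \<omega> \<partial>M)"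
      by (intro nn_integral_mono mult_left_mono indicator_leI)
         (auto intro: subsetD[OF B_mono[OF le_add2]])
    also have "\<dots> \<le> ennreal (x - \<delta>)"
    proof (rule cancel)
      have "(\<integral>\<^sup>+\<omega>\<in>B (j + n). ?v \<omega> \<partial>M) + ennreal \<delta> \<le> (\<integral>\<^sup>+\<omega>\<in>B (j + n). ?v \<omega> \<partial>M) +
          (\<integral>\<^sup>+\<omega>\<in>space M - B (j + n). ennreal (S (j + n) \<omega>) \<partial>M)"
        by (intro add_left_mono lost)
      also have "\<dots> = ennreal x"
        unfolding B_def by (rule drop_time_optional_stopping(2))
      finally show "(\<integral>\<^sup>+\<omega>\<in>B (j + n). ?v \<omega> \<partial>M) + ennreal \<delta> \<le> ennreal x" .
    qed
    finally show ?thesis .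
  qed
  \<comment> \<open>Measurability is known for the truncations of \<open>?v\<close> to
    \<open>B n\<close>, not for \<open>?v\<close>. Since the drop time is almost surely finite,
    \<open>?v\<close> may be exchanged for their supremum, to which monotone convergence
    applies.\<close>
  have "(\<integral>\<^sup>+\<omega>. ?v \<omega> \<partial>M) = (\<integral>\<^sup>+\<omega>. (SUP n. ?v \<omega> * indicator (B n) \<omega>) \<partial>M)"
  proof (rule nn_integral_cong_AE)
    show "AE \<omega> in M. ?v \<omega> = (SUP n. ?v \<omega> * indicator (B n) \<omega>)"
      using AE_drop_time_finite[of "Suc j"] AE_space
    proof eventually_elim
      case (elim \<omega>)
      then obtain n where "\<omega> \<in> B n" by (auto simp: B_def)
      then have "?v \<omega> \<le> (SUP n. ?v \<omega> * indicator (B n) \<omega>)"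
        by (intro SUP_upper2[of n]) auto
      moreover have "(SUP n. ?v \<omega> * indicator (B n) \<omega>) \<le> ?v \<omega>"
        by (rule SUP_least) (auto simp: indicator_def)
      ultimately show ?case by (rule antisym)
    qed
  qed
  also have "\<dots> = (SUP n. \<integral>\<^sup>+\<omega>\<in>B n. ?v \<omega> \<partial>M)"
  proof (rule nn_integral_monotone_convergence_SUP)
    show "incseq (\<lambda>n \<omega>. ?v \<omega> * indicator (B n) \<omega>)"
    proof (intro monoI le_funI mult_left_mono indicator_leI)
      fix m n :: nat and \<omega> assume "m \<le> n" "\<omega> \<in> B m"
      then show "\<omega> \<in> B n" using B_mono by blast
    qed simp
    show "(\<lambda>\<omega>. ?v \<omega> * indicator (B n) \<omega>) \<in> borel_measurable M" for n
      unfolding B_def by (rule drop_time_optional_stopping(1))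
  qed
  also have "\<dots> \<le> ennreal (x - \<delta>)"
    by (rule SUP_least) (rule stopped_le)
  also have "\<dots> < ennreal x"
    using \<delta>_pos x by (intro ennreal_lessI) auto
  finally show ?thesis
    unfolding bubble_def nn_integral_S by (intro exI[of _ "Suc j"]) simp
qed

end

section \<open>From the infimum and the supremum to constants\<close>

theorem corollary3p14:
  fixes K :: "real \<Rightarrow> real measure"
    and P :: "real \<Rightarrow> 'a measure"
    and S :: "nat \<Rightarrow> 'a \<Rightarrow> real"
  assumes "martingale_kernel K"
    and "\<And>x. x > 0 \<Longrightarrow> markov_chain_from K x (P x) S"
    and "(INF x\<in>{0<..}. drop_prob K x) > 0"
    and "(SUP x\<in>{0<..}. ereal (x * drop_mean K x)) < \<infinity>"
  shows "\<forall>x>0. \<not> as_bounded (P x) S \<longrightarrow> bubble (P x) S"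
proof (intro allI impI)
  fix x :: real assume x: "0 < x" and unb: "\<not> as_bounded (P x) S"
  interpret prob_space "P x"
    using assms(2)[OF x] by (simp add: markov_chain_from_def)
  interpret martingale_chain "P x" K x S
    by unfold_locales (use assms(1,2) x in auto)
  define c where "c = (INF x\<in>{0<..}. drop_prob K x)"
  \<comment> \<open>A supremum in \<open>ereal\<close> that differs from \<infinity> lies below some
    natural number, which serves as \<open>C\<close>.\<close>
  obtain C :: real where C: "(SUP x\<in>{0<..}. ereal (x * drop_mean K x)) < ereal C"
    using less_PInf_Ex_of_nat[THEN iffD1, OF less_imp_neq[OF assms(4)]] by auto
  interpret dropping_martingale_chain "P x" K x S c C
  proof
    show "0 < c" using assms(3) by (simp add: c_def)
    show "c \<le> drop_prob K y" if "0 < y" for y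
      \<comment> \<open>A real infimum is a lower bound only if the family is bounded below; for
        probabilities 0 is such a bound.\<close>
      unfolding c_def using that
      by (intro cINF_lower bdd_belowI[where m = 0]) (auto simp: drop_prob_def)
    show "y * drop_mean K y \<le> C" if "0 < y" for y
    proof -
      have "ereal (y * drop_mean K y) \<le> (SUP x\<in>{0<..}. ereal (x * drop_mean K x))"
        using that by (intro SUP_upper) auto
      with C show ?thesis by (metis ereal_less_eq(3) le_less_trans less_imp_le)
    qed
  qed
  show "bubble (P x) S" using x unb by (rule bubble_if_unbounded)
qed

end
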